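(* Let $Y$ be a real random variable whose moment generating function $E[e^{tY}]$ exists for $|t|<r$, for some $r>0$. Then for any integer $n\ge 0$ and every real $x$, $$B_{n}^{(L,Y)}(x)=\sum_{k=0}^{n} B_{n,k}\big(xE[\langle Y\rangle_{1}],\, xE[\langle Y\rangle_{2}],\,\dots,\, xE[\langle Y\rangle_{n-k+1}]\big).$$
   Context: Rising factorial: $\langle x\rangle_0=1$, $\langle x\rangle_n=x(x+1)\cdots(x+n-1)$ for $n\ge 1$. Partial Bell polynomials $B_{n,k}$ ($n\ge k\ge 0$) are defined by the formal power series identity $$\frac{1}{k!}\left(\sum_{j=1}^{\infty}x_{j}\frac{t^{j}}{j!}\right)^{k}=\sum_{n=k}^{\infty}B_{n,k}(x_{1},x_{2},\dots,x_{n-k+1})\frac{t^{n}}{n!}.$$ The probabilistic Lah numbers $L_Y(n,k)$ ($n\ge k\ge 0$) associated with $Y$ are defined by the power series expansion about $t=0$ $$\frac{1}{k!}\left(E\left[\left(\frac{1}{1-t}\right)^{Y}\right]-1\right)^{k}=\sum_{n=k}^{\infty}L_{Y}(n,k)\frac{t^{n}}{n!},\quad k\ge 0.$$ The probabilistic Lah-Bell polynomials associated with $Y$ are $B_{n}^{(L,Y)}(x)=\sum_{k=0}^{n}L_{Y}(n,k)x^{k}$, $n\ge 0$. *)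

theory Defs
  imports "HOL-Probability.Probability" "HOL-Analysis.FPS_Convergence"
begin

text \<open>
  The argument is an infinite sequence whose entry \<open>x 0\<close> is ignored; by \<open>partial_bell_cong\<close>
  below only \<open>x 1, \<dots>, x (n - k + 1)\<close> matter when \<open>k \<le> n\<close>.
\<close>
definition partial_bell :: "nat \<Rightarrow> nat \<Rightarrow> (nat \<Rightarrow> 'a::field_char_0) \<Rightarrow> 'a" where
  "partial_bell n k x =
     fact n * fps_nth (fps_const (1 / fact k) *
       Abs_fps (\<lambda>j. if j = 0 then 0 else x j / fact j) ^ k) n"

text \<open>
  The power series about \<open>0\<close> representing \<open>(E[(1/(1-t))^Y] - 1)^k / k!\<close> for \<open>t\<close> near \<open>0\<close>.
  It is unique by \<open>has_fps_expansion_real_unique\<close>.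
\<close>
definition prob_lah_fps :: "'a measure \<Rightarrow> ('a \<Rightarrow> real) \<Rightarrow> nat \<Rightarrow> real fps" where
  "prob_lah_fps M Y k =
     (THE F. (\<lambda>t. 1 / fact k * ((\<integral>\<omega>. (1 / (1 - t)) powr Y \<omega> \<partial>M) - 1) ^ k)
               has_fps_expansion F)"

definition prob_lah :: "'a measure \<Rightarrow> ('a \<Rightarrow> real) \<Rightarrow> nat \<Rightarrow> nat \<Rightarrow> real" where
  "prob_lah M Y n k = fact n * fps_nth (prob_lah_fps M Y k) n"

definition prob_lah_bell :: "'a measure \<Rightarrow> ('a \<Rightarrow> real) \<Rightarrow> nat \<Rightarrow> real \<Rightarrow> real" where
  "prob_lah_bell M Y n x = (\<Sum>k=0..n. prob_lah M Y n k * x ^ k)"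

lemma partial_bell_eq_0:
  assumes "n < k"
  shows "partial_bell n k x = 0"
  using assms startsby_zero_power_prefix[of "Abs_fps (\<lambda>j. if j = 0 then 0 else x j / fact j)" k]
  by (simp add: partial_bell_def)

lemma fps_nth_power_cong:
  fixes A B :: "'a::comm_ring_1 fps"
  assumes "\<And>i. i \<le> m \<Longrightarrow> fps_nth A i = fps_nth B i" and "i \<le> m"
  shows "fps_nth (A ^ k) i = fps_nth (B ^ k) i"
  using assms(2)
proof (induction k arbitrary: i)
  case (Suc k)
  then show ?case
    by (auto simp: fps_mult_nth assms(1) intro!: sum.cong)
qed simp

lemma partial_bell_cong:
  assumes "\<And>j. 1 \<le> j \<Longrightarrow> j \<le> n - k + 1 \<Longrightarrow> x j = y j"
  shows "partial_bell n k x = partial_bell n k y"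
proof (cases "n < k")
  case False
  define G where "G = (\<lambda>x::nat \<Rightarrow> 'a. Abs_fps (\<lambda>j. x (Suc j) / fact (Suc j)))"
  have shift: "Abs_fps (\<lambda>j. if j = 0 then 0 else x j / fact j) = fps_X * G x" for x :: "nat \<Rightarrow> 'a"
    by (rule fps_ext) (auto simp: G_def simp del: fact_Suc)
  have "fps_nth (G x ^ k) (n - k) = fps_nth (G y ^ k) (n - k)"
    by (rule fps_nth_power_cong[of "n - k"]) (auto simp: G_def assms)
  with False show ?thesis
    by (simp add: partial_bell_def shift power_mult_distrib fps_X_power_mult_nth)
qed (simp add: partial_bell_eq_0)

lemma has_fps_expansion_real_unique:
  fixes f :: "real \<Rightarrow> real"
  assumes "f has_fps_expansion F" "f has_fps_expansion G"
  shows "F = G"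
proof (rule ccontr)
  assume "F \<noteq> G"
  define H where "H = F - G"
  have "H \<noteq> 0" using \<open>F \<noteq> G\<close> by (simp add: H_def)
  define m where "m = subdegree H"
  define K where "K = fps_shift m H"
  have H: "H = K * fps_X ^ m"
    by (simp add: K_def m_def subdegree_decompose[symmetric])
  have K0: "fps_nth K 0 \<noteq> 0"
    using \<open>H \<noteq> 0\<close> by (simp add: K_def m_def)
  have "(\<lambda>t. f t - f t) has_fps_expansion H"
    unfolding H_def by (intro has_fps_expansion_diff assms)
  then have radH: "fps_conv_radius H > 0" and evH: "eventually (\<lambda>t. eval_fps H t = 0) (nhds 0)"
    by (auto simp: has_fps_expansion_def)
  have radK: "fps_conv_radius K > 0"
    using radH by (simp add: K_def)
  have "eventually (\<lambda>t::real. t \<in> eball 0 (fps_conv_radius K)) (nhds 0)"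
    using radK by (intro eventually_nhds_in_open) (auto simp: zero_ereal_def)
  with evH have "eventually (\<lambda>t. t \<noteq> 0 \<longrightarrow> eval_fps K t = 0) (nhds 0)"
    by eventually_elim (auto simp: H eval_fps_mult in_eball_iff)
  then have ev: "eventually (\<lambda>t. eval_fps K t = 0) (at 0)"
    by (simp add: eventually_at_filter)
  have "isCont (eval_fps K) 0"
    using radK by (intro continuous_eval_fps) (auto simp: zero_ereal_def)
  then have "(eval_fps K \<longlongrightarrow> eval_fps K 0) (at 0)"
    by (simp add: isCont_def)
  moreover have "(eval_fps K \<longlongrightarrow> 0) (at 0)"
    using ev by (rule tendsto_eventually)
  ultimately have "eval_fps K 0 = 0"
    by (rule LIM_unique)
  with K0 show False
    by (simp add: eval_fps_at_0)
qed

lemma prob_lah_fps_eqI: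
  assumes "(\<lambda>t. 1 / fact k * ((\<integral>\<omega>. (1 / (1 - t)) powr Y \<omega> \<partial>M) - 1) ^ k) has_fps_expansion F"
  shows "prob_lah_fps M Y k = F"
  unfolding prob_lah_fps_def
  using assms has_fps_expansion_real_unique by blast

end

theory Submission
  imports Defs
begin

text \<open>
  By the binomial series, \<open>(1/(1-t))^Y\<close> is the series \<open>\<Sum>j. \<langle>Y\<rangle>\<^sub>j t^j / j!\<close>. Its absolute
  values sum to at most \<open>(1/(1-\<bar>t\<bar>))^\<bar>Y\<bar> \<le> exp (s Y) + exp (- s Y)\<close> with
  \<open>s = - ln (1 - \<bar>t\<bar>)\<close>, which is integrable once \<open>s < r\<close>. So the expectation may be taken
  termwise, and the theorem becomes a comparison of coefficients: scaling the arguments of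
  \<open>B\<^sub>n\<^sub>,\<^sub>k\<close> by \<open>x\<close> multiplies its value by \<open>x^k\<close>.
\<close>

lemma pochhammer_sums_powr:
  fixes y t :: real
  assumes "\<bar>t\<bar> < 1"
  shows "(\<lambda>n. pochhammer y n / fact n * t ^ n) sums (1 / (1 - t)) powr y"
proof -
  have "(\<lambda>n. (- y gchoose n) * (- t) ^ n) sums (1 + (- t)) powr (- y)"
    using assms by (intro gen_binomial_real) simp
  \<comment> \<open>The sign \<open>(- 1) ^ n\<close> in the binomial coefficient of
    \<open>- y\<close> cancels the one in \<open>(- t) ^ n\<close>.\<close>
  moreover have "(- y gchoose n) * (- t) ^ n = pochhammer y n / fact n * t ^ n" for n
    unfolding gbinomial_pochhammer power_minus[of t] by simp
  moreover have "(1 + (- t)) powr (- y) = (1 / (1 - t)) powr y"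
    using assms by (simp add: powr_def ln_div)
  ultimately show ?thesis by simp
qed

text \<open>The triangle inequality, applied to each factor \<open>y + i\<close>. This makes the
  series with \<open>\<bar>y\<bar>\<close> in place of \<open>y\<close> a majorant.\<close>

lemma abs_pochhammer_le:
  fixes y :: "'a::linordered_idom"
  shows "\<bar>pochhammer y n\<bar> \<le> pochhammer \<bar>y\<bar> n"
  unfolding pochhammer_prod abs_prod
  by (intro prod_mono) (auto intro: order_trans[OF abs_triangle_ineq])

lemma borel_measurable_pochhammer [measurable]:
  fixes f :: "'a \<Rightarrow> real"
  assumes [measurable]: "f \<in> borel_measurable M"
  shows "(\<lambda>x. pochhammer (f x) n) \<in> borel_measurable M"
  unfolding pochhammer_prod by measurable

lemma expectation_powr_sums:
  fixes Y :: "'a \<Rightarrow> real"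
  assumes [measurable]: "Y \<in> borel_measurable M"
    and exp: "\<And>t::real. \<bar>t\<bar> < r \<Longrightarrow> integrable M (\<lambda>\<omega>. exp (t * Y \<omega>))"
    and t: "\<bar>t\<bar> < 1 - exp (- r)"
  shows "(\<lambda>n. (\<integral>\<omega>. pochhammer (Y \<omega>) n \<partial>M) / fact n * t ^ n) sums
           (\<integral>\<omega>. (1 / (1 - t)) powr Y \<omega> \<partial>M)"
proof -
  have t1: "\<bar>t\<bar> < 1"
    using t exp_gt_zero[of "- r"] by linarith
  \<comment> \<open>Chosen so that \<open>(1 / (1 - \<bar>t\<bar>)) powr a = exp (s * a)\<close>.
    The radius \<open>1 - exp (- r)\<close> is the one for which \<open>s < r\<close>.\<close>
  define s where "s = - ln (1 - \<bar>t\<bar>)"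
  have "s \<ge> 0"
    using t1 by (simp add: s_def)
  have "ln (exp (- r)) < ln (1 - \<bar>t\<bar>)"
    using t t1 by (subst ln_less_cancel_iff) auto
  then have "s < r"
    by (simp add: s_def)
  define f where "f n \<omega> = pochhammer (Y \<omega>) n / fact n * t ^ n" for n \<omega>
  define g where "g \<omega> = exp (s * Y \<omega>) + exp ((- s) * Y \<omega>)" for \<omega>
  have g: "integrable M g"
    unfolding g_def using \<open>s \<ge> 0\<close> \<open>s < r\<close> by (intro Bochner_Integration.integrable_add exp) auto
  have [measurable]: "f n \<in> borel_measurable M" for n
    unfolding f_def by measurable
  have sums: "(\<lambda>n. f n \<omega>) sums (1 / (1 - t)) powr Y \<omega>" for \<omega>
    unfolding f_def using t1 by (rule pochhammer_sums_powr)
  \<comment> \<open>The binomial series at \<open>\<bar>Y \<omega>\<bar>\<close> and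
    \<open>\<bar>t\<bar>\<close>: its terms are nonnegative and dominate those of \<open>f\<close>,
    and its sum has a closed form.\<close>
  define h where "h n \<omega> = pochhammer \<bar>Y \<omega>\<bar> n / fact n * \<bar>t\<bar> ^ n" for n \<omega>
  have h_sums: "(\<lambda>n. h n \<omega>) sums (1 / (1 - \<bar>t\<bar>)) powr \<bar>Y \<omega>\<bar>" for \<omega>
    unfolding h_def using t1 by (intro pochhammer_sums_powr) simp
  have f_le_h: "norm (f n \<omega>) \<le> h n \<omega>" for n \<omega>
    unfolding f_def h_def
    by (auto simp: abs_mult power_abs intro!: mult_right_mono divide_right_mono abs_pochhammer_le)
  have h_nonneg: "h n \<omega> \<ge> 0" for n \<omega>
    using f_le_h[of n \<omega>] norm_ge_zero[of "f n \<omega>"] by linarith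
  have summable_f: "summable (\<lambda>n. norm (f n \<omega>))" for \<omega>
    by (rule summable_comparison_test'[OF sums_summable[OF h_sums]]) (use f_le_h in auto)
  have partial_le: "(\<Sum>i<n. norm (f i \<omega>)) \<le> g \<omega>" for n \<omega>
  proof -
    have "(\<Sum>i<n. norm (f i \<omega>)) \<le> (\<Sum>i<n. h i \<omega>)"
      by (intro sum_mono f_le_h)
    also have "\<dots> \<le> (1 / (1 - \<bar>t\<bar>)) powr \<bar>Y \<omega>\<bar>"
      using sum_le_suminf[OF sums_summable[OF h_sums], of "{..<n}"] sums_unique[OF h_sums] h_nonneg
      by simp
    also have "\<dots> = exp (s * \<bar>Y \<omega>\<bar>)"
      using t1 by (simp add: powr_def ln_div s_def)
    \<comment> \<open>\<open>\<bar>Y \<omega>\<bar>\<close> is \<open>Y \<omega>\<close> or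
      \<open>- Y \<omega>\<close>, so the left side is one of the two positive summands of
      \<open>g \<omega>\<close>.\<close>
    also have "\<dots> \<le> g \<omega>"
      by (auto simp: g_def abs_if)
    finally show ?thesis .
  qed
  have int_f: "integrable M (f n)" for n
  proof (rule Bochner_Integration.integrable_bound[OF g])
    have "norm (f n \<omega>) \<le> norm (g \<omega>)" for \<omega>
    proof -
      \<comment> \<open>\<open>Suc n\<close> puts the index \<open>n\<close> itself inside the
        partial sum, which \<open>g\<close> bounds.\<close>
      have "norm (f n \<omega>) \<le> (\<Sum>i<Suc n. norm (f i \<omega>))"
        by (rule member_le_sum) auto
      also have "\<dots> \<le> norm (g \<omega>)"
        using partial_le[where n = "Suc n" and \<omega> = \<omega>] unfolding real_norm_def
        by (rule order_trans[OF _ abs_ge_self])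
      finally show ?thesis .
    qed
    then show "AE \<omega> in M. norm (f n \<omega>) \<le> norm (g \<omega>)" by simp
  qed measurable
  \<comment> \<open>Integrating the bound by \<open>g\<close>, which is uniform in \<open>n\<close>,
    bounds all partial sums here. This absolute summability justifies exchanging sum and
    integral.\<close>
  have "summable (\<lambda>n. \<integral>\<omega>. norm (f n \<omega>) \<partial>M)"
  proof (rule summableI_nonneg_bounded)
    fix n
    have "(\<Sum>i<n. \<integral>\<omega>. norm (f i \<omega>) \<partial>M) = (\<integral>\<omega>. (\<Sum>i<n. norm (f i \<omega>)) \<partial>M)"
      using int_f by (intro Bochner_Integration.integral_sum[symmetric]) auto
    also have "\<dots> \<le> integral\<^sup>L M g"
      using int_f g by (intro integral_mono partial_le Bochner_Integration.integrable_sum) auto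
    finally show "(\<Sum>i<n. \<integral>\<omega>. norm (f i \<omega>) \<partial>M) \<le> integral\<^sup>L M g" .
  qed simp
  then have "(\<lambda>n. integral\<^sup>L M (f n)) sums (\<integral>\<omega>. (\<Sum>n. f n \<omega>) \<partial>M)"
    using int_f summable_f by (intro sums_integral) auto
  moreover have "integral\<^sup>L M (f n) = (\<integral>\<omega>. pochhammer (Y \<omega>) n \<partial>M) / fact n * t ^ n" for n
    by (simp add: f_def[abs_def])
  moreover have "(\<Sum>n. f n \<omega>) = (1 / (1 - t)) powr Y \<omega>" for \<omega>
    using sums by (rule sums_unique[symmetric])
  ultimately show ?thesis by simp
qed

text \<open>Since \<open>r > 0\<close>, the radius \<open>1 - exp (- r)\<close> is positive, so the
  termwise expectation holds in a whole neighbourhood of \<open>0\<close>.\<close>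

lemma expectation_powr_has_fps_expansion:
  fixes Y :: "'a \<Rightarrow> real"
  assumes "Y \<in> borel_measurable M" and "r > 0"
    and "\<And>t::real. \<bar>t\<bar> < r \<Longrightarrow> integrable M (\<lambda>\<omega>. exp (t * Y \<omega>))"
  shows "(\<lambda>t. \<integral>\<omega>. (1 / (1 - t)) powr Y \<omega> \<partial>M) has_fps_expansion
           Abs_fps (\<lambda>n. (\<integral>\<omega>. pochhammer (Y \<omega>) n \<partial>M) / fact n)"
proof (rule has_fps_expansionI)
  have "eventually (\<lambda>t::real. t \<in> ball 0 (1 - exp (- r))) (nhds 0)"
    using \<open>r > 0\<close> by (intro eventually_nhds_in_open) auto
  then show "eventually (\<lambda>t. (\<lambda>n. fps_nth (Abs_fps (\<lambda>n. (\<integral>\<omega>. pochhammer (Y \<omega>) n \<partial>M) / fact n)) n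
      * t ^ n) sums (\<integral>\<omega>. (1 / (1 - t)) powr Y \<omega> \<partial>M)) (nhds 0)"
    by eventually_elim (use expectation_powr_sums[OF assms(1,3)] in auto)
qed

lemma has_fps_expansion_power:
  fixes f :: "'a::{banach, real_normed_field} \<Rightarrow> 'a"
  assumes "f has_fps_expansion F"
  shows "(\<lambda>t. f t ^ k) has_fps_expansion F ^ k"
  by (induction k) (auto intro: has_fps_expansion_mult assms)

text \<open>Uniqueness of the expansion identifies \<open>prob_lah_fps\<close> with the series that
  defines \<open>partial_bell\<close>, taken at the rising moments of \<open>Y\<close>.\<close>

lemma prob_lah_eq_partial_bell:
  fixes Y :: "'a \<Rightarrow> real"
  assumes "prob_space M" and "Y \<in> borel_measurable M" and "r > 0"
    and "\<And>t::real. \<bar>t\<bar> < r \<Longrightarrow> integrable M (\<lambda>\<omega>. exp (t * Y \<omega>))"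
  shows "prob_lah M Y n k = partial_bell n k (\<lambda>j. \<integral>\<omega>. pochhammer (Y \<omega>) j \<partial>M)"
proof -
  let ?e = "\<lambda>j. \<integral>\<omega>. pochhammer (Y \<omega>) j \<partial>M"
  interpret prob_space M by fact
  have "Abs_fps (\<lambda>j. ?e j / fact j) - 1 = Abs_fps (\<lambda>j. if j = 0 then 0 else ?e j / fact j)"
    \<comment> \<open>At index \<open>0\<close> the moment is the total mass \<open>1\<close>, which
      the subtracted \<open>1\<close> cancels.\<close>
    by (rule fps_ext) (simp add: prob_space)
  moreover have "(\<lambda>t. (\<integral>\<omega>. (1 / (1 - t)) powr Y \<omega> \<partial>M) - 1) has_fps_expansion
      Abs_fps (\<lambda>j. ?e j / fact j) - 1"
    by (intro has_fps_expansion_diff has_fps_expansion_1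
        expectation_powr_has_fps_expansion[OF assms(2-4)])
  ultimately have "prob_lah_fps M Y k =
      fps_const (1 / fact k) * Abs_fps (\<lambda>j. if j = 0 then 0 else ?e j / fact j) ^ k"
    by (intro prob_lah_fps_eqI has_fps_expansion_mult has_fps_expansion_const
        has_fps_expansion_power) simp
  then show ?thesis
    by (simp add: prob_lah_def partial_bell_def)
qed

text \<open>The inner series is linear in the arguments, so \<open>c\<close> factors out of it
  before the \<open>k\<close>-th power is taken.\<close>

lemma partial_bell_scale:
  "partial_bell n k (\<lambda>j. c * x j) = c ^ k * partial_bell n k x"
proof -
  have "Abs_fps (\<lambda>j. if j = 0 then 0 else c * x j / fact j) =
      fps_const c * Abs_fps (\<lambda>j. if j = 0 then 0 else x j / fact j)"
    by (rule fps_ext) simp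
  then show ?thesis
    by (simp add: partial_bell_def power_mult_distrib)
qed

theorem theorem2p5:
  fixes M :: "'a measure" and Y :: "'a \<Rightarrow> real" and r x :: real and n :: nat
  assumes "prob_space M"
    and "Y \<in> borel_measurable M"
    and "r > 0"
    and "\<And>t::real. \<bar>t\<bar> < r \<Longrightarrow> integrable M (\<lambda>\<omega>. exp (t * Y \<omega>))"
  shows "prob_lah_bell M Y n x =
    (\<Sum>k=0..n. partial_bell n k (\<lambda>j. x * (\<integral>\<omega>. pochhammer (Y \<omega>) j \<partial>M)))"
  by (simp add: prob_lah_bell_def prob_lah_eq_partial_bell[OF assms] partial_bell_scale mult.commute)

end
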